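(* Let $\mathcal{M}$ be a Hadamard manifold, $\mathcal{D}\subseteq\mathcal{M}$ a nonempty open set, $x_0\in\mathcal{D}$, and $f:\mathcal{D}\to\mathcal{I}(\mathbb{R})$ an interval valued function which is $gH$-Gâteaux differentiable at $x_0$. Suppose that $x_0$ is an efficient point of the problem $\min_{x\in\mathcal{D}}f(x)$ and that $f_G(x_0)(\exp_{x_0}^{-1}y)\ne[a,0]$ for all $y\in\mathcal{D}$ and all $a<0$. Then $x_0$ is a solution of the Stampacchia Riemannian interval variational inequality problem with $T(x_0)=f_G(x_0)$, i.e. $$f_G(x_0)(\exp_{x_0}^{-1}y)\nprec\mathbf{0}\quad\text{for all }y\in\mathcal{D}.$$
   Context: $\mathcal{I}(\mathbb{R})$ is the set of closed bounded intervals $[\underline{a},\overline{a}]$ with $\underline{a}\le\overline{a}$ real; $\mathbf{0}=[0,0]$. Sums and scalar multiples are Minkowski: $A+B=[\underline{a}+\underline{b},\overline{a}+\overline{b}]$, and $\lambda A=[\lambda\underline{a},\lambda\overline{a}]$ if $\lambda\ge0$, $\lambda A=[\lambda\overline{a},\lambda\underline{a}]$ if $\lambda<0$. The $gH$-difference is $A-_{gH}B=[\min\{\underline{a}-\underline{b},\overline{a}-\overline{b}\},\max\{\underline{a}-\underline{b},\overline{a}-\overline{b}\}]$. The Hausdorff metric is $d_H(A,B)=\max\{|\underline{a}-\underline{b}|,|\overline{a}-\overline{b}|\}$; limits of intervals are taken in $d_H$. Order: $A\preceq B$ iff $\underline{a}\le\underline{b}$ and $\overline{a}\le\overline{b}$;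 $A\prec B$ iff $A\preceq B$ and $A\ne B$; $A\nprec B$ means that $A\prec B$ fails. A Hadamard manifold is a simply connected complete Riemannian manifold of nonpositive sectional curvature; $\exp_x:T_x\mathcal{M}\to\mathcal{M}$ is then a diffeomorphism. For $\mathcal{D}$ open, $f$ has $gH$-directional derivative $f'(x,v)\in\mathcal{I}(\mathbb{R})$ at $x\in\mathcal{D}$ in direction $v\in T_x\mathcal{M}$ if the limit $f'(x,v)=\lim_{t\to0^+}\frac1t\big(f(\exp_x(tv))-_{gH}f(x)\big)$ exists; $f$ is $gH$-directional differentiable at $x$ if this holds for every $v\in T_x\mathcal{M}$. For a finite-dimensional real normed space $V$, a map $F:V\to\mathcal{I}(\mathbb{R})$ is linear if (i) $F(\lambda v)=\lambda F(v)$ for all $v\in V,\lambda\in\mathbb{R}$, and (ii) for all $v,w\in V$, either $F(v)+F(w)=F(v+w)$ or neither $F(v)+F(w)\prec F(v+w)$ nor $F(v+w)\prec F(v)+F(w)$. It is $gH$-continuous if $\lim_{\|h\|\to0}(F(v+h)-_{gH}F(v))=\mathbf{0}$ for every $v\in V$. $f$ is $gH$-Gâteaux differentiable at $x_0$ if it is $gH$-directional differentiable at $x_0$ and $f_G(x_0)(\cdot):=f'(x_0,\cdot):T_{x_0}\mathcal{M}\to\mathcal{I}(\mathbb{R})$ is linear and $gH$-continuous. A point $x_0\in\mathcal{D}$ is an efficient point (solution) of $\min_{x\in\mathcal{D}}f(x)$ if $f(x)\nprec f(x_0)$ for all $x\in\mathcal{D}$. Given a map $T$ assigning to points $x\in\mathcal{D}$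 a $gH$-continuous linear map $T(x):T_x\mathcal{M}\to\mathcal{I}(\mathbb{R})$, the Stampacchia Riemannian interval variational inequality problem is to find $x_0\in\mathcal{D}$ with $T(x_0)(\exp_{x_0}^{-1}y)\nprec\mathbf{0}$ for all $y\in\mathcal{D}$. *)

theory Defs
  imports "HOL-Analysis.Analysis" "HOL-Library.Interval"
begin

section \<open>Interval analysis\<close>

text \<open>
  Closed bounded intervals are the elements of \<^typ>\<open>real interval\<close>. The library's addition and zero
  on this type are Minkowski addition and \<open>[0,0]\<close>; its subtraction is not the $gH$-difference, and
  its \<open>\<le>\<close> is inclusion, not the order used here.
\<close>

definition iscale :: "real \<Rightarrow> real interval \<Rightarrow> real interval" (infixr \<open>*\<^sub>I\<close> 75) where
  "c *\<^sub>I A =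
     (if 0 \<le> c then Interval (c * lower A, c * upper A) else Interval (c * upper A, c * lower A))"

definition gH_diff :: "real interval \<Rightarrow> real interval \<Rightarrow> real interval" (infixl \<open>-\<^sub>g\<^sub>H\<close> 65) where
  "A -\<^sub>g\<^sub>H B =
     Interval (min (lower A - lower B) (upper A - upper B),
               max (lower A - lower B) (upper A - upper B))"

definition hausdorff_dist :: "real interval \<Rightarrow> real interval \<Rightarrow> real" where
  "hausdorff_dist A B = max \<bar>lower A - lower B\<bar> \<bar>upper A - upper B\<bar>"

definition itendsto :: "('a \<Rightarrow> real interval) \<Rightarrow> real interval \<Rightarrow> 'a filter \<Rightarrow> bool" where
  "itendsto F L net \<longleftrightarrow> ((\<lambda>x. hausdorff_dist (F x) L) \<longlongrightarrow> 0) net"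

definition ipreceq :: "real interval \<Rightarrow> real interval \<Rightarrow> bool" (infix \<open>\<preceq>\<^sub>I\<close> 50) where
  "A \<preceq>\<^sub>I B \<longleftrightarrow> lower A \<le> lower B \<and> upper A \<le> upper B"

definition iprec :: "real interval \<Rightarrow> real interval \<Rightarrow> bool" (infix \<open>\<prec>\<^sub>I\<close> 50) where
  "A \<prec>\<^sub>I B \<longleftrightarrow> A \<preceq>\<^sub>I B \<and> A \<noteq> B"

definition gH_linear :: "('v::real_vector \<Rightarrow> real interval) \<Rightarrow> bool" where
  "gH_linear F \<longleftrightarrow>
     (\<forall>c v. F (c *\<^sub>R v) = c *\<^sub>I F v) \<and>
     (\<forall>v w. F v + F w = F (v + w) \<or>
            \<not> F v + F w \<prec>\<^sub>I F (v + w) \<and> \<not> F (v + w) \<prec>\<^sub>I F v + F w)"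

text \<open>
  The norm is an explicit argument \<open>N\<close>, because a tangent space carries the norm given by the
  Riemannian metric and not the one of the type representing it.
\<close>

definition gH_continuous :: "('v::real_vector \<Rightarrow> real) \<Rightarrow> ('v \<Rightarrow> real interval) \<Rightarrow> bool" where
  "gH_continuous N F \<longleftrightarrow>
     (\<forall>v. itendsto (\<lambda>h. F (v + h) -\<^sub>g\<^sub>H F v) 0 (filtercomap N (at_right 0)))"


section \<open>Smooth manifolds\<close>

text \<open>
  For open \<open>S\<close> in a finite-dimensional space, \<open>Ck_on k S f\<close> says that \<open>f\<close> is of class $C^k$ on \<open>S\<close>.
\<close>

primrec Ck_on :: "nat \<Rightarrow> 'a::euclidean_space set \<Rightarrow> ('a \<Rightarrow> 'b::real_normed_vector) \<Rightarrow> bool" where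
  "Ck_on 0 S f \<longleftrightarrow> continuous_on S f"
| "Ck_on (Suc k) S f \<longleftrightarrow>
     (\<forall>x\<in>S. f differentiable at x) \<and> (\<forall>v. Ck_on k S (\<lambda>x. frechet_derivative f (at x) v))"

definition smooth_on :: "'a::euclidean_space set \<Rightarrow> ('a \<Rightarrow> 'b::real_normed_vector) \<Rightarrow> bool" where
  "smooth_on S f \<longleftrightarrow> (\<forall>k. Ck_on k S f)"

text \<open>
  A chart is a domain with a map that is relevant only on this domain.
\<close>

type_synonym ('m, 'e) chart = "'m set \<times> ('m \<Rightarrow> 'e)"

abbreviation cdom :: "('m, 'e) chart \<Rightarrow> 'm set" where
  "cdom \<equiv> fst"

abbreviation cmap :: "('m, 'e) chart \<Rightarrow> 'm \<Rightarrow> 'e" where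
  "cmap \<equiv> snd"

abbreviation cimg :: "('m, 'e) chart \<Rightarrow> 'e set" where
  "cimg c \<equiv> cmap c ` cdom c"

definition cinv :: "('m, 'e) chart \<Rightarrow> 'e \<Rightarrow> 'm" where
  "cinv c = inv_into (cdom c) (cmap c)"

definition is_chart :: "('m::topological_space, 'e::euclidean_space) chart \<Rightarrow> bool" where
  "is_chart c \<longleftrightarrow>
     open (cdom c) \<and> open (cimg c) \<and> homeomorphism (cdom c) (cimg c) (cmap c) (cinv c)"

text \<open>
  The points of the manifold are all elements of the type \<open>'m\<close>, which carries the manifold topology.
  Besides a smooth atlas, the structure selects for every point \<open>x\<close> a chart \<open>chart_at x\<close> around \<open>x\<close>,
  and a tangent vector at \<open>x\<close> is represented by its components in that chart. Hence the tangent
  space $T_x\mathcal{M}$ is (as a vector space) the whole type \<open>'e\<close>, and \<open>metric x\<close> is the inner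
  product on $T_x\mathcal{M}$ in this representation.
\<close>

record ('m, 'e) riemannian_structure =
  atlas :: "('m, 'e) chart set"
  chart_at :: "'m \<Rightarrow> ('m, 'e) chart"
  metric :: "'m \<Rightarrow> 'e \<Rightarrow> 'e \<Rightarrow> real"

definition smooth_manifold ::
  "('m::{t2_space,second_countable_topology}, 'e::euclidean_space) riemannian_structure \<Rightarrow> bool"
where
  "smooth_manifold M \<longleftrightarrow>
     (\<forall>c\<in>atlas M. is_chart c) \<and>
     (\<forall>x. chart_at M x \<in> atlas M \<and> x \<in> cdom (chart_at M x)) \<and>
     (\<forall>c\<in>atlas M. \<forall>d\<in>atlas M. smooth_on (cmap c ` (cdom c \<inter> cdom d)) (cmap d \<circ> cinv c))"


section \<open>Riemannian manifolds\<close>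

text \<open>
  \<open>to_chart_at M c p u\<close> is the tangent vector at \<open>cinv c p\<close> with components \<open>u\<close> in the chart \<open>c\<close>,
  re-expressed in the selected chart at that point. So \<open>local_metric M c p\<close> is the metric tensor in
  the coordinates of the chart \<open>c\<close>.
\<close>

definition to_chart_at ::
  "('m, 'e::euclidean_space) riemannian_structure \<Rightarrow> ('m, 'e) chart \<Rightarrow> 'e \<Rightarrow> 'e \<Rightarrow> 'e" where
  "to_chart_at M c p u =
     frechet_derivative (cmap (chart_at M (cinv c p)) \<circ> cinv c) (at p) u"

definition local_metric ::
  "('m, 'e::euclidean_space) riemannian_structure \<Rightarrow> ('m, 'e) chart \<Rightarrow> 'e \<Rightarrow> 'e \<Rightarrow> 'e \<Rightarrow> real"
where
  "local_metric M c p u w = metric M (cinv c p) (to_chart_at M c p u) (to_chart_at M c p w)"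

definition riemannian_manifold ::
  "('m::{t2_space,second_countable_topology}, 'e::euclidean_space) riemannian_structure \<Rightarrow> bool"
where
  "riemannian_manifold M \<longleftrightarrow>
     smooth_manifold M \<and>
     (\<forall>x. bilinear (metric M x) \<and>
          (\<forall>u w. metric M x u w = metric M x w u) \<and>
          (\<forall>u. u \<noteq> 0 \<longrightarrow> 0 < metric M x u u)) \<and>
     (\<forall>c\<in>atlas M. \<forall>u w. smooth_on (cimg c) (\<lambda>p. local_metric M c p u w))"

definition riemannian_norm ::
  "('m, 'e::euclidean_space) riemannian_structure \<Rightarrow> 'm \<Rightarrow> 'e \<Rightarrow> real" where
  "riemannian_norm M x v = sqrt (metric M x v v)"

text \<open>
  \<open>christoffel M c p u w\<close> $= \sum_{i,j} u^i w^j \Gamma^k_{ij}(p) e_k$ is given by the Christoffel symbols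
  of the Levi-Civita connection in the chart \<open>c\<close>: the index of
  $g_{kl}\Gamma^k_{ij} = \frac12(\partial_i g_{jl} + \partial_j g_{il} - \partial_l g_{ij})$
  is contracted with \<open>u\<close>, \<open>w\<close> and an arbitrary vector \<open>y\<close>.
\<close>

definition christoffel ::
  "('m, 'e::euclidean_space) riemannian_structure \<Rightarrow> ('m, 'e) chart \<Rightarrow> 'e \<Rightarrow> 'e \<Rightarrow> 'e \<Rightarrow> 'e" where
  "christoffel M c p u w =
     (let dg = (\<lambda>d a b. frechet_derivative (\<lambda>q. local_metric M c q a b) (at p) d)
      in THE z. \<forall>y. local_metric M c p z y = (dg u w y + dg w u y - dg y u w) / 2)"

text \<open>
  The components in the chart \<open>c\<close> of the Riemann curvature tensor \<open>R(u,v)w\<close>, with the convention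
  $R(X,Y)Z = \nabla_X\nabla_Y Z - \nabla_Y\nabla_X Z - \nabla_{[X,Y]}Z$.
\<close>

definition curvature ::
  "('m, 'e::euclidean_space) riemannian_structure \<Rightarrow> ('m, 'e) chart \<Rightarrow> 'e \<Rightarrow> 'e \<Rightarrow> 'e \<Rightarrow> 'e \<Rightarrow> 'e"
where
  "curvature M c p u v w =
     frechet_derivative (\<lambda>q. christoffel M c q v w) (at p) u
     - frechet_derivative (\<lambda>q. christoffel M c q u w) (at p) v
     + christoffel M c p u (christoffel M c p v w)
     - christoffel M c p v (christoffel M c p u w)"

definition sectional_curvature ::
  "('m, 'e::euclidean_space) riemannian_structure \<Rightarrow> 'm \<Rightarrow> 'e \<Rightarrow> 'e \<Rightarrow> real" where
  "sectional_curvature M x u v =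
     (let c = chart_at M x
      in metric M x (curvature M c (cmap c x) u v v) u
         / (metric M x u u * metric M x v v - (metric M x u v)\<^sup>2))"

text \<open>
  A curve defined on all of \<open>\<real>\<close> is a geodesic if in every chart it satisfies the geodesic equation
  $\ddot\sigma + \Gamma_\sigma(\dot\sigma,\dot\sigma) = 0$.
\<close>

definition geodesic ::
  "('m::topological_space, 'e::euclidean_space) riemannian_structure \<Rightarrow> (real \<Rightarrow> 'm) \<Rightarrow> bool" where
  "geodesic M \<gamma> \<longleftrightarrow>
     continuous_on UNIV \<gamma> \<and>
     (\<forall>c\<in>atlas M. \<exists>\<sigma>'. \<forall>t. \<gamma> t \<in> cdom c \<longrightarrow>
        ((cmap c \<circ> \<gamma>) has_vector_derivative \<sigma>' t) (at t) \<and>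
        (\<sigma>' has_vector_derivative - christoffel M c (cmap c (\<gamma> t)) (\<sigma>' t) (\<sigma>' t)) (at t))"

definition geodesic_from ::
  "('m::topological_space, 'e::euclidean_space) riemannian_structure \<Rightarrow> 'm \<Rightarrow> 'e \<Rightarrow> (real \<Rightarrow> 'm) \<Rightarrow> bool"
where
  "geodesic_from M x v \<gamma> \<longleftrightarrow>
     geodesic M \<gamma> \<and> \<gamma> 0 = x \<and> ((cmap (chart_at M x) \<circ> \<gamma>) has_vector_derivative v) (at 0)"

text \<open>Completeness is understood as geodesic completeness.\<close>

definition geodesically_complete ::
  "('m::topological_space, 'e::euclidean_space) riemannian_structure \<Rightarrow> bool" where
  "geodesically_complete M \<longleftrightarrow> (\<forall>x v. \<exists>\<gamma>. geodesic_from M x v \<gamma>)"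

definition hadamard_manifold ::
  "('m::{t2_space,second_countable_topology}, 'e::euclidean_space) riemannian_structure \<Rightarrow> bool"
where
  "hadamard_manifold M \<longleftrightarrow>
     riemannian_manifold M \<and>
     geodesically_complete M \<and>
     simply_connected (UNIV :: 'm set) \<and>
     (\<forall>x u v. independent {u, v} \<and> u \<noteq> v \<longrightarrow> sectional_curvature M x u v \<le> 0)"

text \<open>
  In a complete manifold the geodesic with given initial data exists on \<open>\<real>\<close> and is unique, so the
  description below denotes its value at time 1.
\<close>

definition exp_map ::
  "('m::topological_space, 'e::euclidean_space) riemannian_structure \<Rightarrow> 'm \<Rightarrow> 'e \<Rightarrow> 'm" where
  "exp_map M x v = (THE y. \<exists>\<gamma>. geodesic_from M x v \<gamma> \<and> \<gamma> 1 = y)"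

definition exp_map_inv ::
  "('m::topological_space, 'e::euclidean_space) riemannian_structure \<Rightarrow> 'm \<Rightarrow> 'm \<Rightarrow> 'e" where
  "exp_map_inv M x = inv (exp_map M x)"


section \<open>Differentiability of interval valued functions\<close>

text \<open>
  An interval valued function on an open set \<open>D\<close> is a total function whose values outside \<open>D\<close> do not
  matter: the derivative at a point of \<open>D\<close> is a limit that depends only on values near that point.
\<close>

definition has_gH_dir_deriv ::
  "('m::topological_space, 'e::euclidean_space) riemannian_structure \<Rightarrow>
     ('m \<Rightarrow> real interval) \<Rightarrow> 'm \<Rightarrow> 'e \<Rightarrow> real interval \<Rightarrow> bool" where
  "has_gH_dir_deriv M f x v L \<longleftrightarrow>
     itendsto (\<lambda>t. (1 / t) *\<^sub>I (f (exp_map M x (t *\<^sub>R v)) -\<^sub>g\<^sub>H f x)) L (at_right 0)"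

definition gH_dir_differentiable ::
  "('m::topological_space, 'e::euclidean_space) riemannian_structure \<Rightarrow>
     ('m \<Rightarrow> real interval) \<Rightarrow> 'm \<Rightarrow> bool" where
  "gH_dir_differentiable M f x \<longleftrightarrow> (\<forall>v. \<exists>L. has_gH_dir_deriv M f x v L)"

definition gH_dir_deriv ::
  "('m::topological_space, 'e::euclidean_space) riemannian_structure \<Rightarrow>
     ('m \<Rightarrow> real interval) \<Rightarrow> 'm \<Rightarrow> 'e \<Rightarrow> real interval" where
  "gH_dir_deriv M f x v = (THE L. has_gH_dir_deriv M f x v L)"

definition gateaux_deriv ::
  "('m::topological_space, 'e::euclidean_space) riemannian_structure \<Rightarrow>
     ('m \<Rightarrow> real interval) \<Rightarrow> 'm \<Rightarrow> 'e \<Rightarrow> real interval" where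
  "gateaux_deriv M f x = (\<lambda>v. gH_dir_deriv M f x v)"

definition gH_gateaux_differentiable ::
  "('m::topological_space, 'e::euclidean_space) riemannian_structure \<Rightarrow>
     ('m \<Rightarrow> real interval) \<Rightarrow> 'm \<Rightarrow> bool" where
  "gH_gateaux_differentiable M f x \<longleftrightarrow>
     gH_dir_differentiable M f x \<and>
     gH_linear (gateaux_deriv M f x) \<and>
     gH_continuous (riemannian_norm M x) (gateaux_deriv M f x)"


section \<open>Efficient points and the Stampacchia variational inequality\<close>

definition efficient_point :: "'m set \<Rightarrow> ('m \<Rightarrow> real interval) \<Rightarrow> 'm \<Rightarrow> bool" where
  "efficient_point D f x\<^sub>0 \<longleftrightarrow> x\<^sub>0 \<in> D \<and> (\<forall>x\<in>D. \<not> f x \<prec>\<^sub>I f x\<^sub>0)"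

text \<open>
  \<open>T\<close> need not be meaningful at every point; a solution \<open>x\<^sub>0\<close> must be a point where \<open>T x\<^sub>0\<close> is a
  $gH$-continuous linear map.
\<close>

definition stampacchia_solution ::
  "('m::topological_space, 'e::euclidean_space) riemannian_structure \<Rightarrow>
     'm set \<Rightarrow> ('m \<Rightarrow> 'e \<Rightarrow> real interval) \<Rightarrow> 'm \<Rightarrow> bool" where
  "stampacchia_solution M D T x\<^sub>0 \<longleftrightarrow>
     x\<^sub>0 \<in> D \<and>
     gH_linear (T x\<^sub>0) \<and> gH_continuous (riemannian_norm M x\<^sub>0) (T x\<^sub>0) \<and>
     (\<forall>y\<in>D. \<not> T x\<^sub>0 (exp_map_inv M x\<^sub>0 y) \<prec>\<^sub>I 0)"

end

theory Submission
  imports Defs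
begin

text \<open>
  If $f_G(x_0)(v) \prec \mathbf{0}$, then the upper end of this interval is negative, since otherwise it
  would be \<open>[a,0]\<close> with \<open>a < 0\<close>. So $f(\exp_{x_0}(tv)) \prec f(x_0)$ for all small \<open>t > 0\<close>, which
  contradicts efficiency as soon as $\exp_{x_0}(tv)$ lies in the open set \<open>D\<close>. For this it suffices that
  $\exp_{x_0}(tv)$ is the value at \<open>t\<close> of the geodesic with initial velocity \<open>v\<close>, which is continuous.
  That identity rests on the uniqueness of geodesics: the Christoffel symbols solve a nondegenerate
  linear system with Lipschitz coefficients, so the geodesic equation has a locally Lipschitz right
  hand side, and the set of times around which two geodesics agree is open and closed.
\<close>

section \<open>Locally Lipschitz functions\<close>

text \<open>Localised at a point because the functions of interest are meaningful only on an open
  coordinate domain, and local uniqueness for an ODE uses the estimate only near the initial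
  value.\<close>

definition loclip_at :: "('a::metric_space \<Rightarrow> 'b::metric_space) \<Rightarrow> 'a \<Rightarrow> bool" where
  "loclip_at f x \<longleftrightarrow> (\<exists>e>0. \<exists>C. C-lipschitz_on (ball x e) f)"

lemma loclip_atI:
  assumes "e > 0" "\<And>y z. y \<in> ball x e \<Longrightarrow> z \<in> ball x e \<Longrightarrow> dist (f y) (f z) \<le> C * dist y z"
  shows "loclip_at f x"
proof -
  \<comment> \<open>\<open>lipschitz_on\<close> demands a nonnegative constant; the absolute value
    spares users of this rule that proof.\<close>
  have "\<bar>C\<bar>-lipschitz_on (ball x e) f"
  proof (rule lipschitz_onI)
    fix y z assume "y \<in> ball x e" "z \<in> ball x e"
    then have "dist (f y) (f z) \<le> C * dist y z" by (rule assms(2))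
    also have "\<dots> \<le> \<bar>C\<bar> * dist y z" by (intro mult_right_mono) auto
    finally show "dist (f y) (f z) \<le> \<bar>C\<bar> * dist y z" .
  qed simp
  with \<open>e > 0\<close> show ?thesis unfolding loclip_at_def by blast
qed

lemma loclip_at_const: "loclip_at (\<lambda>_. c) x"
  by (rule loclip_atI[where e = 1 and C = 0]) auto

lemma loclip_at_bounded_linear: "bounded_linear f \<Longrightarrow> loclip_at f x"
  unfolding loclip_at_def using bounded_linear.lipschitz_boundE lipschitz_on_subset
  by (metis subset_UNIV zero_less_one)

lemma loclip_at_add:
  fixes f g :: "'a::metric_space \<Rightarrow> 'b::real_normed_vector"
  assumes "loclip_at f x" "loclip_at g x"
  shows "loclip_at (\<lambda>y. f y + g y) x"
proof -
  obtain d C e K where *: "d > 0" "C-lipschitz_on (ball x d) f" "e > 0" "K-lipschitz_on (ball x e) g"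
    using assms unfolding loclip_at_def by blast
  then have "(C + K)-lipschitz_on (ball x (min d e)) (\<lambda>y. f y + g y)"
    by (intro lipschitz_on_add) (auto intro: lipschitz_on_subset)
  with * show ?thesis unfolding loclip_at_def by (metis min_less_iff_conj)
qed

lemma loclip_at_sum:
  fixes f :: "'i \<Rightarrow> 'a::metric_space \<Rightarrow> 'b::real_normed_vector"
  assumes "\<And>i. i \<in> I \<Longrightarrow> loclip_at (f i) x"
  shows "loclip_at (\<lambda>y. \<Sum>i\<in>I. f i y) x"
  using assms
  by (induction I rule: infinite_finite_induct) (auto intro: loclip_at_const loclip_at_add)

lemma loclip_at_mult:
  fixes f g :: "'a::metric_space \<Rightarrow> real"
  assumes "loclip_at f x" "loclip_at g x"
  shows "loclip_at (\<lambda>y. f y * g y) x"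
proof -
  obtain d C e K where *: "d > 0" "C-lipschitz_on (ball x d) f" "e > 0" "K-lipschitz_on (ball x e) g"
    using assms unfolding loclip_at_def by blast
  have CK: "0 \<le> C" "0 \<le> K" using * lipschitz_on_nonneg by blast+
  \<comment> \<open>A product of Lipschitz functions is Lipschitz where both factors are bounded.
    Radius at most 1 bounds each factor by its value at the centre plus its Lipschitz
    constant.\<close>
  define r where "r = min 1 (min d e)"
  have "r > 0" using * by (simp add: r_def)
  have bd: "\<bar>h y\<bar> \<le> \<bar>h x\<bar> + B" if "B-lipschitz_on (ball x s) h" "r \<le> s" "y \<in> ball x r"
    for h :: "'a \<Rightarrow> real" and B s y
  proof -
    have "dist (h y) (h x) \<le> B * dist y x"
      using that \<open>r > 0\<close> by (intro lipschitz_onD[OF that(1)]) auto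
    also have "\<dots> \<le> B * 1"
      using that lipschitz_on_nonneg[OF that(1)]
      by (intro mult_left_mono) (auto simp: r_def dist_commute)
    finally show ?thesis by (simp add: dist_real_def)
  qed
  show ?thesis
  proof (rule loclip_atI[OF \<open>r > 0\<close>, where C = "(\<bar>f x\<bar> + C) * K + C * (\<bar>g x\<bar> + K)"])
    fix y z assume yz: "y \<in> ball x r" "z \<in> ball x r"
    have r: "r \<le> d" "r \<le> e" by (auto simp: r_def)
    have f: "\<bar>f y - f z\<bar> \<le> C * dist y z"
      using lipschitz_onD[OF *(2), of y z] yz r by (auto simp: dist_real_def)
    have g: "\<bar>g y - g z\<bar> \<le> K * dist y z"
      using lipschitz_onD[OF *(4), of y z] yz r by (auto simp: dist_real_def)
    have "f y * g y - f z * g z = f y * (g y - g z) + (f y - f z) * g z"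
      by (simp add: algebra_simps)
    also have "\<bar>\<dots>\<bar> \<le> \<bar>f y\<bar> * \<bar>g y - g z\<bar> + \<bar>f y - f z\<bar> * \<bar>g z\<bar>"
      by (metis abs_mult abs_triangle_ineq)
    also have "\<dots> \<le> (\<bar>f x\<bar> + C) * (K * dist y z) + (C * dist y z) * (\<bar>g x\<bar> + K)"
      using bd[OF *(2) r(1) yz(1)] bd[OF *(4) r(2) yz(2)] f g CK
      by (intro add_mono mult_mono) auto
    finally show "dist (f y * g y) (f z * g z) \<le> ((\<bar>f x\<bar> + C) * K + C * (\<bar>g x\<bar> + K)) * dist y z"
      by (simp add: dist_real_def algebra_simps)
  qed
qed

lemma loclip_at_cong:
  assumes "eventually (\<lambda>y. f y = g y) (nhds x)" "loclip_at g x"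
  shows "loclip_at f x"
proof -
  obtain d where d: "d > 0" "\<And>y. dist y x < d \<Longrightarrow> f y = g y"
    using assms(1) unfolding eventually_nhds_metric by blast
  obtain e C where e: "e > 0" "C-lipschitz_on (ball x e) g"
    using assms(2) unfolding loclip_at_def by blast
  show ?thesis
  proof (rule loclip_atI)
    show "min d e > 0" using d e by simp
    show "dist (f y) (f z) \<le> C * dist y z"
      if "y \<in> ball x (min d e)" "z \<in> ball x (min d e)" for y z
      using that d(2) lipschitz_onD[OF e(2), of y z] by (auto simp: dist_commute)
  qed
qed

lemma loclip_at_minus:
  fixes f :: "'a::metric_space \<Rightarrow> 'b::real_normed_vector"
  assumes "loclip_at f x"
  shows "loclip_at (\<lambda>y. - f y) x"
proof -
  obtain e C where e: "e > 0" "C-lipschitz_on (ball x e) f"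
    using assms unfolding loclip_at_def by blast
  from e(1) lipschitz_on_minus[OF e(2)] show ?thesis unfolding loclip_at_def by blast
qed

lemma loclip_at_scaleR_const:
  fixes f :: "'a::metric_space \<Rightarrow> real"
  assumes "loclip_at f x"
  shows "loclip_at (\<lambda>y. f y *\<^sub>R (c :: 'b::real_normed_vector)) x"
proof -
  obtain e C where e: "e > 0" "C-lipschitz_on (ball x e) f"
    using assms unfolding loclip_at_def by blast
  show ?thesis
  proof (rule loclip_atI[OF e(1), where C = "C * norm c"])
    fix y z assume "y \<in> ball x e" "z \<in> ball x e"
    then have "dist (f y) (f z) \<le> C * dist y z" by (rule lipschitz_onD[OF e(2)])
    then have "dist (f y) (f z) * norm c \<le> C * dist y z * norm c" by (rule mult_right_mono) simp
    then show "dist (f y *\<^sub>R c) (f z *\<^sub>R c) \<le> C * norm c * dist y z"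
      by (simp add: dist_norm scaleR_diff_left[symmetric] ac_simps)
  qed
qed

text \<open>Turns coefficients depending on the position alone into functions of position and
  velocity, the variables of the geodesic equation as a first-order system.\<close>

lemma loclip_at_compose_fst:
  assumes "loclip_at f p"
  shows "loclip_at (\<lambda>(y, _). f y) (p, u)"
proof -
  obtain e C where *: "e > 0" "C-lipschitz_on (ball p e) f"
    using assms unfolding loclip_at_def by blast
  show ?thesis
  proof (rule loclip_atI[OF *(1), where C = C], clarify)
    fix a b a' b' assume "(a, b) \<in> ball (p, u) e" "(a', b') \<in> ball (p, u) e"
    then have "a \<in> ball p e" "a' \<in> ball p e"
      using dist_fst_le[of "(p, u)" "(a, b)"] dist_fst_le[of "(p, u)" "(a', b')"] by auto
    then have "dist (f a) (f a') \<le> C * dist a a'" by (rule lipschitz_onD[OF *(2)])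
    also have "\<dots> \<le> C * dist (a, b) (a', b')"
      using dist_fst_le[of "(a, b)" "(a', b')"] lipschitz_on_nonneg[OF *(2)]
      by (intro mult_left_mono) auto
    finally show "dist (f a) (f a') \<le> C * dist (a, b) (a', b')" .
  qed
qed

lemma loclip_at_Pair:
  assumes "loclip_at f x" "loclip_at g x"
  shows "loclip_at (\<lambda>y. (f y, g y)) x"
proof -
  obtain d C e K where *: "d > 0" "C-lipschitz_on (ball x d) f" "e > 0" "K-lipschitz_on (ball x e) g"
    using assms unfolding loclip_at_def by blast
  then have "(sqrt (C\<^sup>2 + K\<^sup>2))-lipschitz_on (ball x (min d e)) (\<lambda>y. (f y, g y))"
    by (intro lipschitz_on_Pair) (auto intro: lipschitz_on_subset)
  with * show ?thesis unfolding loclip_at_def by (metis min_less_iff_conj)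
qed

section \<open>Lipschitz dependence of solutions of linear systems\<close>

lemma linear_Basis_expansion:
  fixes f :: "'e::euclidean_space \<Rightarrow> 'b::real_vector"
  assumes "linear f"
  shows "f v = (\<Sum>i\<in>Basis. (v \<bullet> i) *\<^sub>R f i)"
  using linear_sum[OF assms, of "\<lambda>i. (v \<bullet> i) *\<^sub>R i" Basis]
  by (simp add: euclidean_representation linear_scale[OF assms])

text \<open>The partial derivatives are continuous, hence bounded on a compact ball. Expanding a
  vector in the basis turns this into a bound for the operator norm of the derivative, and the mean
  value inequality on the convex ball gives the Lipschitz constant.\<close>

lemma Ck_on_loclip_at:
  fixes f :: "'a::euclidean_space \<Rightarrow> 'b::real_normed_vector"
  assumes "Ck_on (Suc 0) S f" "open S" "x \<in> S"
  shows "loclip_at f x"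
proof -
  obtain e where e: "e > 0" "cball x e \<subseteq> S" using assms open_contains_cball by blast
  let ?D = "\<lambda>y. frechet_derivative f (at y)"
  have der: "(f has_derivative ?D y) (at y)" if "y \<in> S" for y
    using assms that frechet_derivative_works by auto
  have "\<exists>B. \<forall>y\<in>cball x e. norm (?D y b) \<le> B" for b
  proof -
    have "continuous_on (cball x e) (\<lambda>y. ?D y b)"
      using assms e(2) by (auto intro: continuous_on_subset)
    then have "bounded ((\<lambda>y. ?D y b) ` cball x e)"
      by (intro compact_imp_bounded compact_continuous_image) auto
    then show ?thesis unfolding bounded_iff by blast
  qed
  then obtain B where B: "\<And>b y. y \<in> cball x e \<Longrightarrow> norm (?D y b) \<le> B b" by metis
  have "onorm (?D y) \<le> (\<Sum>b\<in>Basis. B b)" if "y \<in> cball x e" for y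
  proof (rule onorm_le)
    fix h
    have lin: "linear (?D y)" using der e that has_derivative_linear by blast
    have "norm (?D y h) = norm (\<Sum>b\<in>Basis. (h \<bullet> b) *\<^sub>R ?D y b)"
      by (rule arg_cong[where f = norm], rule linear_Basis_expansion[OF lin])
    also have "\<dots> \<le> (\<Sum>b\<in>Basis. norm h * B b)"
      using B[OF that] by (intro sum_norm_le) (auto intro!: mult_mono Basis_le_norm)
    finally show "norm (?D y h) \<le> (\<Sum>b\<in>Basis. B b) * norm h"
      by (simp add: sum_distrib_left ac_simps)
  qed
  moreover have "(f has_derivative ?D y) (at y within cball x e)" if "y \<in> cball x e" for y
    using der that e(2) by (blast intro: has_derivative_at_withinI)
  ultimately have "dist (f y) (f z) \<le> (\<Sum>b\<in>Basis. B b) * dist y z"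
    if "y \<in> ball x e" "z \<in> ball x e" for y z
    unfolding dist_norm using that by (intro differentiable_bound[of "cball x e" f "?D"]) auto
  with e(1) show ?thesis by (rule loclip_atI)
qed

text \<open>An injective operator in finite dimension is bounded below, and this survives small
  perturbations. So the solution is controlled by the right hand side, and differences of solutions
  by differences of the data.\<close>

lemma loclip_at_linear_solution:
  fixes a :: "'x::metric_space \<Rightarrow> 'e::euclidean_space \<Rightarrow>\<^sub>L 'f::euclidean_space"
  assumes a: "loclip_at a x\<^sub>0" and b: "loclip_at b x\<^sub>0"
    and inj: "inj (blinfun_apply (a x\<^sub>0))"
    and z: "eventually (\<lambda>x. blinfun_apply (a x) (z x) = b x) (nhds x\<^sub>0)"
  shows "loclip_at z x\<^sub>0"
proof -
  obtain d C e K where *: "d > 0" "C-lipschitz_on (ball x\<^sub>0 d) a" "e > 0" "K-lipschitz_on (ball x\<^sub>0 e) b"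
    using a b unfolding loclip_at_def by blast
  have CK: "0 \<le> C" "0 \<le> K" using * lipschitz_on_nonneg by blast+
  obtain \<rho> where \<rho>: "\<rho> > 0" "\<And>x. dist x x\<^sub>0 < \<rho> \<Longrightarrow> blinfun_apply (a x) (z x) = b x"
    using z unfolding eventually_nhds_metric by blast
  obtain m where m: "m > 0" "\<And>v. m * norm v \<le> norm (blinfun_apply (a x\<^sub>0) v)"
    using linear_inj_bounded_below_pos[OF bounded_linear.linear[OF blinfun.bounded_linear_right] inj] by blast
  \<comment> \<open>The last entry keeps \<open>a x\<close> within \<open>m / 2\<close> of
    \<open>a x\<^sub>0\<close>, so at most half of the lower bound \<open>m\<close> is lost;
    \<open>C + 1\<close> avoids dividing by zero. The entry 1 serves the bound on \<open>b\<close>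
    behind \<open>B\<close>.\<close>
  define s where "s = Min {1, d, e, \<rho>, m / (2 * (C + 1))}"
  have "s > 0" using * \<rho> m CK by (auto simp: s_def)
  have s: "s \<le> 1" "s \<le> d" "s \<le> e" "s \<le> \<rho>" "s \<le> m / (2 * (C + 1))"
    by (auto simp: s_def)
  have sC: "C * s \<le> m / 2"
  proof -
    have "C * s \<le> (C + 1) * (m / (2 * (C + 1)))"
      using CK s(5) \<open>s > 0\<close> by (intro mult_mono) auto
    also have "\<dots> = m / 2" using CK by (simp add: add_nonneg_eq_0_iff divide_simps)
    finally show ?thesis .
  qed
  have below: "m / 2 * norm v \<le> norm (blinfun_apply (a x) v)" if x: "x \<in> ball x\<^sub>0 s" for x v
  proof -
    have "norm (a x\<^sub>0 - a x) \<le> C * dist x\<^sub>0 x"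
      using lipschitz_onD[OF *(2), of x\<^sub>0 x] x s *(1) by (auto simp: dist_norm)
    also have "\<dots> \<le> C * s" using x CK by (intro mult_left_mono) auto
    finally have "norm (a x\<^sub>0 - a x) \<le> m / 2" using sC by simp
    then have "norm (blinfun_apply (a x\<^sub>0 - a x) v) \<le> m / 2 * norm v"
      by (meson mult_right_mono norm_blinfun norm_ge_zero order_trans)
    moreover have "norm (blinfun_apply (a x\<^sub>0) v)
        \<le> norm (blinfun_apply (a x\<^sub>0 - a x) v) + norm (blinfun_apply (a x) v)"
      using norm_triangle_ineq[of "blinfun_apply (a x\<^sub>0 - a x) v" "blinfun_apply (a x) v"]
      by (simp add: blinfun.diff_left)
    ultimately show ?thesis using m(2)[of v] by (simp add: field_simps)
  qed
  define B where "B = 2 / m * (norm (b x\<^sub>0) + K)"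
  have zB: "norm (z x) \<le> B" if x: "x \<in> ball x\<^sub>0 s" for x
  proof -
    have "norm (b x - b x\<^sub>0) \<le> K * dist x x\<^sub>0"
      using lipschitz_onD[OF *(4), of x x\<^sub>0] x s *(3) by (auto simp: dist_norm)
    also have "\<dots> \<le> K * 1"
      using x CK s by (intro mult_left_mono) (auto simp: dist_commute)
    finally have "norm (b x) \<le> norm (b x\<^sub>0) + K"
      using norm_triangle_ineq2[of "b x" "b x\<^sub>0"] by simp
    moreover have "blinfun_apply (a x) (z x) = b x"
      using x s by (intro \<rho>(2)) (auto simp: dist_commute)
    ultimately have "m / 2 * norm (z x) \<le> norm (b x\<^sub>0) + K"
      using below[OF x, of "z x"] by simp
    then show ?thesis using m(1) by (simp add: B_def field_simps)
  qed
  show ?thesis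
  proof (rule loclip_atI[OF \<open>s > 0\<close>, where C = "2 / m * (K + C * B)"])
    fix x y assume xy: "x \<in> ball x\<^sub>0 s" "y \<in> ball x\<^sub>0 s"
    have eq: "blinfun_apply (a x) (z x) = b x" "blinfun_apply (a y) (z y) = b y"
      using xy s by (auto intro!: \<rho>(2) simp: dist_commute)
    have da: "norm (a x - a y) \<le> C * dist x y"
      using lipschitz_onD[OF *(2), of x y] xy s by (auto simp: dist_norm)
    have db: "norm (b x - b y) \<le> K * dist x y"
      using lipschitz_onD[OF *(4), of x y] xy s by (auto simp: dist_norm)
    \<comment> \<open>Subtracting the two systems leaves one for \<open>z x - z y\<close> whose
      right hand side contains only differences of data, multiplied at most by the bounded
      \<open>z y\<close>.\<close>
    have "blinfun_apply (a x) (z x - z y) = (b x - b y) - blinfun_apply (a x - a y) (z y)"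
      by (simp add: blinfun.diff_left blinfun.diff_right eq)
    then have "m / 2 * norm (z x - z y) \<le> norm (b x - b y) + norm (blinfun_apply (a x - a y) (z y))"
      using below[OF xy(1), of "z x - z y"] by (metis norm_triangle_ineq4 order_trans)
    also have "\<dots> \<le> K * dist x y + (C * dist x y) * B"
      using db norm_blinfun[of "a x - a y" "z y"] mult_mono[OF da zB[OF xy(2)]] CK
      by (intro add_mono) auto
    finally show "dist (z x) (z y) \<le> 2 / m * (K + C * B) * dist x y"
      using m(1) by (simp add: dist_norm field_simps)
  qed
qed

section \<open>Linear systems given by a bilinear form\<close>

lemma bilinear_Basis_expansion:
  fixes A :: "'e::euclidean_space \<Rightarrow> 'e \<Rightarrow> 'b::real_vector"
  assumes "bilinear A"
  shows "A u w = (\<Sum>i\<in>Basis. \<Sum>j\<in>Basis. ((u \<bullet> i) * (w \<bullet> j)) *\<^sub>R A i j)"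
proof -
  have lin: "linear (\<lambda>u. A u w)" "linear (A u)" for u w
    using assms unfolding bilinear_def by blast+
  have "A u w = (\<Sum>i\<in>Basis. (u \<bullet> i) *\<^sub>R A i w)"
    using linear_Basis_expansion[OF lin(1)] .
  also have "\<dots> = (\<Sum>i\<in>Basis. (u \<bullet> i) *\<^sub>R (\<Sum>j\<in>Basis. (w \<bullet> j) *\<^sub>R A i j))"
    by (intro sum.cong refl arg_cong[where f = "scaleR _"] linear_Basis_expansion lin(2))
  finally show ?thesis by (simp add: scaleR_sum_right)
qed

text \<open>Testing against basis vectors only turns the equation into a linear system with matrix
  entries \<open>A x i j\<close>, so Lipschitz continuity of these finitely many entries
  suffices.\<close>

lemma loclip_at_bilinear_solution:
  fixes A :: "'x::metric_space \<Rightarrow> 'e::euclidean_space \<Rightarrow> 'e \<Rightarrow> real"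
  assumes U: "open U" "x\<^sub>0 \<in> U"
    and A: "\<And>x. x \<in> U \<Longrightarrow> bilinear (A x)" and \<beta>: "\<And>x. x \<in> U \<Longrightarrow> linear (\<beta> x)"
    and lipA: "\<And>i j. i \<in> Basis \<Longrightarrow> j \<in> Basis \<Longrightarrow> loclip_at (\<lambda>x. A x i j) x\<^sub>0"
    and lip\<beta>: "\<And>j. j \<in> Basis \<Longrightarrow> loclip_at (\<lambda>x. \<beta> x j) x\<^sub>0"
    and pos: "\<And>v. v \<noteq> 0 \<Longrightarrow> A x\<^sub>0 v v \<noteq> 0"
    and z: "\<And>x y. x \<in> U \<Longrightarrow> A x (z x) y = \<beta> x y"
  shows "loclip_at z x\<^sub>0"
proof -
  \<comment> \<open>Matrix units: with them \<open>a\<close> is a finite sum of scalar functions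
    times fixed operators.\<close>
  define E where "E i j = Blinfun (\<lambda>v. (v \<bullet> i) *\<^sub>R j)" for i j :: 'e
  have E: "blinfun_apply (E i j) v = (v \<bullet> i) *\<^sub>R j" for i j v
    unfolding E_def by (subst bounded_linear_Blinfun_apply) (auto intro!: bounded_linear_intros)
  define a where "a x = (\<Sum>i\<in>Basis. \<Sum>j\<in>Basis. A x i j *\<^sub>R E i j)" for x
  define b where "b x = (\<Sum>j\<in>Basis. \<beta> x j *\<^sub>R j)" for x
  have a: "blinfun_apply (a x) v = (\<Sum>j\<in>Basis. A x v j *\<^sub>R j)" if "x \<in> U" for x v
  proof -
    have "A x v j = (\<Sum>i\<in>Basis. (v \<bullet> i) * A x i j)" for j
      using linear_Basis_expansion[of "\<lambda>v. A x v j" v] A[OF that] by (simp add: bilinear_def)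
    then have "(\<Sum>j\<in>Basis. A x v j *\<^sub>R j) = (\<Sum>j\<in>Basis. \<Sum>i\<in>Basis. ((v \<bullet> i) * A x i j) *\<^sub>R j)"
      by (simp add: scaleR_sum_left)
    also have "\<dots> = (\<Sum>i\<in>Basis. \<Sum>j\<in>Basis. ((v \<bullet> i) * A x i j) *\<^sub>R j)"
      by (rule sum.swap)
    finally show ?thesis
      by (simp add: a_def blinfun.sum_left blinfun.scaleR_left E mult.commute)
  qed
  show ?thesis
  proof (rule loclip_at_linear_solution)
    show "loclip_at a x\<^sub>0" unfolding a_def
      by (intro loclip_at_sum loclip_at_scaleR_const lipA)
    show "loclip_at b x\<^sub>0" unfolding b_def
      by (intro loclip_at_sum loclip_at_scaleR_const lip\<beta>)
    \<comment> \<open>Pairing with \<open>v\<close> recovers the quadratic form, which vanishes only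
      at 0, so the operator has trivial kernel.\<close>
    have "blinfun_apply (a x\<^sub>0) v \<bullet> v = A x\<^sub>0 v v" for v
    proof -
      have "blinfun_apply (a x\<^sub>0) v \<bullet> v = (\<Sum>j\<in>Basis. (v \<bullet> j) * A x\<^sub>0 v j)"
        unfolding a[OF U(2)] inner_sum_left by (simp add: inner_commute mult.commute)
      also have "\<dots> = A x\<^sub>0 v v"
        using linear_Basis_expansion[of "A x\<^sub>0 v" v] A[OF U(2)] by (simp add: bilinear_def)
      finally show ?thesis .
    qed
    with pos have "blinfun_apply (a x\<^sub>0) v \<noteq> 0" if "v \<noteq> 0" for v
      using that by (metis inner_zero_left)
    then show "inj (blinfun_apply (a x\<^sub>0))"
      using linear_injective_0[OF bounded_linear.linear[OF blinfun.bounded_linear_right]] by blast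
    show "eventually (\<lambda>x. blinfun_apply (a x) (z x) = b x) (nhds x\<^sub>0)"
      using eventually_nhds_in_open[OF U] by (rule eventually_mono) (simp add: a b_def z)
  qed
qed

text \<open>A Riesz representation: the map sending \<open>z\<close> to the coefficients of
  \<open>A z\<close> is injective since \<open>A z z\<close> is nonzero for nonzero
  \<open>z\<close>, hence bijective in finite dimension.\<close>

lemma nondegenerate_bilinear_ex1:
  fixes A :: "'e::euclidean_space \<Rightarrow> 'e \<Rightarrow> real"
  assumes A: "bilinear A" and pos: "\<And>v. v \<noteq> 0 \<Longrightarrow> A v v \<noteq> 0" and \<beta>: "linear \<beta>"
  shows "\<exists>!z. \<forall>y. A z y = \<beta> y"
proof -
  have lin: "linear (\<lambda>u. A u w)" "linear (A u)" for u w
    using A unfolding bilinear_def by blast+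
  define L where "L z = (\<Sum>j\<in>Basis. A z j *\<^sub>R j)" for z
  have Lj: "L z \<bullet> j = A z j" if "j \<in> Basis" for z j
    using that by (simp add: L_def inner_sum_left_Basis)
  have L: "linear L" 
    by (rule linearI) (simp_all add: L_def linear_add[OF lin(1)] linear_scale[OF lin(1)]
        scaleR_add_left sum.distrib scaleR_sum_right)
  have "L z \<noteq> 0" if "z \<noteq> 0" for z
  proof
    assume "L z = 0"
    then have "A z j = 0" if "j \<in> Basis" for j
      using Lj[OF that, of z] by simp
    then have "A z z = 0"
      by (subst linear_Basis_expansion[OF lin(2)]) simp
    with pos that show False by blast
  qed
  then have inj: "inj L" using linear_injective_0[OF L] by blast
  then obtain z where z: "L z = (\<Sum>j\<in>Basis. \<beta> j *\<^sub>R j)"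
    using linear_injective_imp_surjective[OF L] by (metis surjD)
  have eq: "A z j = \<beta> j" if "j \<in> Basis" for j
    using that Lj[OF that, of z] by (simp add: z inner_sum_left_Basis)
  show ?thesis
  proof
    show "\<forall>y. A z y = \<beta> y"
      using linear_Basis_expansion[OF lin(2)] linear_Basis_expansion[OF \<beta>] eq by (metis (no_types, lifting) sum.cong)
    fix w assume "\<forall>y. A w y = \<beta> y"
    then have "L w = L z" using eq unfolding L_def by (intro sum.cong) auto
    then show "w = z" using inj by (simp add: inj_eq)
  qed
qed

section \<open>Uniqueness for ordinary differential equations\<close>

lemma ode_unique_right:
  fixes X Y :: "real \<Rightarrow> 'a::real_inner"
  assumes F: "C-lipschitz_on U F"
    and X: "\<And>t. a \<le> t \<Longrightarrow> t \<le> b \<Longrightarrow> X t \<in> U \<and> (X has_vector_derivative F (X t)) (at t)"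
    and Y: "\<And>t. a \<le> t \<Longrightarrow> t \<le> b \<Longrightarrow> Y t \<in> U \<and> (Y has_vector_derivative F (Y t)) (at t)"
    and "X a = Y a" "a \<le> b"
  shows "X b = Y b"
proof -
  \<comment> \<open>Gronwall's argument: the squared distance grows at rate at most
    \<open>2 * C\<close>, so with this weight it is nonincreasing, and it starts at 0.\<close>
  define \<phi> where "\<phi> t = ((X t - Y t) \<bullet> (X t - Y t)) * exp (- (2 * C * t))" for t
  have "\<phi> b \<le> \<phi> a"
  proof (rule DERIV_nonpos_imp_nonincreasing[OF \<open>a \<le> b\<close>])
    fix t assume t: "a \<le> t" "t \<le> b"
    let ?w = "X t - Y t" and ?w' = "F (X t) - F (Y t)"
    have d: "((\<lambda>t. X t - Y t) has_vector_derivative ?w') (at t)"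
      using X Y t by (intro derivative_intros) auto
    have "((\<lambda>t. (X t - Y t) \<bullet> (X t - Y t)) has_field_derivative (?w \<bullet> ?w' + ?w' \<bullet> ?w)) (at t)"
      unfolding has_real_derivative_iff_has_vector_derivative
      using bounded_bilinear.has_vector_derivative[OF bounded_bilinear_inner d d] .
    then have "(\<phi> has_field_derivative
        (2 * (?w \<bullet> ?w') - 2 * C * (?w \<bullet> ?w)) * exp (- (2 * C * t))) (at t)"
      unfolding \<phi>_def
      by (rule DERIV_cong[OF DERIV_mult])
         (auto intro!: derivative_eq_intros simp: inner_commute algebra_simps)
    moreover have "?w \<bullet> ?w' \<le> C * (?w \<bullet> ?w)"
    proof -
      have "?w \<bullet> ?w' \<le> norm ?w * norm ?w'" by (rule norm_cauchy_schwarz)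
      also have "\<dots> \<le> norm ?w * (C * norm ?w)"
        using lipschitz_onD[OF F, of "X t" "Y t"] X Y t
        by (intro mult_left_mono) (auto simp: dist_norm)
      finally show ?thesis by (simp add: dot_square_norm power2_eq_square algebra_simps)
    qed
    ultimately show "\<exists>y. (\<phi> has_field_derivative y) (at t) \<and> y \<le> 0"
      by (intro exI conjI) (auto intro: mult_nonpos_nonneg)
  qed
  moreover have "\<phi> a = 0" using assms by (simp add: \<phi>_def)
  ultimately have "(X b - Y b) \<bullet> (X b - Y b) \<le> 0"
    by (simp add: \<phi>_def mult_le_0_iff not_le[symmetric])
  then show ?thesis by (metis inner_eq_zero_iff inner_ge_zero order_antisym right_minus_eq)
qed

lemma ode_locally_unique:
  fixes X Y :: "real \<Rightarrow> 'a::real_inner"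
  assumes F: "loclip_at F (X t\<^sub>0)"
    and X: "eventually (\<lambda>t. (X has_vector_derivative F (X t)) (at t)) (nhds t\<^sub>0)"
    and Y: "eventually (\<lambda>t. (Y has_vector_derivative F (Y t)) (at t)) (nhds t\<^sub>0)"
    and eq: "X t\<^sub>0 = Y t\<^sub>0"
  shows "eventually (\<lambda>t. X t = Y t) (nhds t\<^sub>0)"
proof -
  obtain e C where e: "e > 0" "C-lipschitz_on (ball (X t\<^sub>0) e) F"
    using F unfolding loclip_at_def by blast
  \<comment> \<open>A solution is differentiable at the initial time, hence continuous there, and so
    remains in the Lipschitz ball for nearby times.\<close>
  have ev: "eventually (\<lambda>t. Z t \<in> ball (X t\<^sub>0) e) (nhds t\<^sub>0)"
    if "eventually (\<lambda>t. (Z has_vector_derivative F (Z t)) (at t)) (nhds t\<^sub>0)" "Z t\<^sub>0 = X t\<^sub>0" for Z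
  proof -
    have "continuous (at t\<^sub>0) Z"
      using eventually_nhds_x_imp_x[OF that(1)] has_vector_derivative_continuous by blast
    then have "(Z \<longlongrightarrow> X t\<^sub>0) (nhds t\<^sub>0)"
      using that(2) by (metis isCont_def tendsto_at_iff_tendsto_nhds)
    then show ?thesis
      using \<open>e > 0\<close> by (auto dest!: tendstoD[of _ _ _ e] simp: dist_commute)
  qed
  have "eventually (\<lambda>t. (X t \<in> ball (X t\<^sub>0) e \<and> (X has_vector_derivative F (X t)) (at t)) \<and>
      (Y t \<in> ball (X t\<^sub>0) e \<and> (Y has_vector_derivative F (Y t)) (at t))) (nhds t\<^sub>0)"
    using ev[OF X] ev[OF Y] X Y eq by (auto intro!: eventually_conj)
  then obtain d where d: "d > 0" and XY: "\<And>t. dist t t\<^sub>0 < d \<Longrightarrow>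
      (X t \<in> ball (X t\<^sub>0) e \<and> (X has_vector_derivative F (X t)) (at t)) \<and>
      (Y t \<in> ball (X t\<^sub>0) e \<and> (Y has_vector_derivative F (Y t)) (at t))"
    unfolding eventually_nhds_metric by blast
  have "X t = Y t" if t: "dist t t\<^sub>0 < d" for t
  proof (cases "t\<^sub>0 \<le> t")
    case True
    then show ?thesis
      using XY t eq by (intro ode_unique_right[OF e(2), of t\<^sub>0 t X Y]) (auto simp: dist_real_def)
  next
    case False
    \<comment> \<open>Times before \<open>t\<^sub>0\<close> are handled by reversing time, which
      replaces \<open>F\<close> by its negative and keeps the Lipschitz constant.\<close>
    have rev: "((\<lambda>s. Z (- s)) has_vector_derivative - F (Z (- s))) (at s)"
      if "(Z has_vector_derivative F (Z (- s))) (at (- s))" for Z s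
    proof -
      have "(uminus has_vector_derivative - 1) (at s)"
        by (auto intro!: derivative_eq_intros)
      from vector_diff_chain_at[OF this that] show ?thesis by (simp add: o_def)
    qed
    have "C-lipschitz_on (ball (X t\<^sub>0) e) (\<lambda>x. - F x)"
      using e(2) by (rule lipschitz_on_minus)
    then have "X (- (- t)) = Y (- (- t))"
      by (rule ode_unique_right[where a = "- t\<^sub>0" and X = "\<lambda>s. X (- s)" and Y = "\<lambda>s. Y (- s)"])
        (use XY t eq False in \<open>auto intro!: rev simp: dist_real_def\<close>)
    then show ?thesis by simp
  qed
  with d show ?thesis unfolding eventually_nhds_metric by blast
qed


section \<open>The metric in coordinates\<close>

lemma smooth_on_differentiable: "smooth_on S f \<Longrightarrow> x \<in> S \<Longrightarrow> f differentiable at x"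
  unfolding smooth_on_def by (metis Ck_on.simps(2))

lemma
  assumes "is_chart c"
  shows cmap_cinv: "p \<in> cimg c \<Longrightarrow> cmap c (cinv c p) = p"
    and cinv_in_cdom: "p \<in> cimg c \<Longrightarrow> cinv c p \<in> cdom c"
    and cinv_cmap: "x \<in> cdom c \<Longrightarrow> cinv c (cmap c x) = x"
  using assms unfolding is_chart_def homeomorphism_def by auto

lemma open_chart_image:
  assumes "is_chart c" "open U"
  shows "open (cmap c ` (cdom c \<inter> U))"
proof -
  have "openin (top_of_set (cimg c)) (cmap c ` (cdom c \<inter> U))"
    using assms unfolding is_chart_def
    by (intro homeomorphism_imp_open_map[of "cdom c" _ _ "cinv c"]) (auto simp: openin_open)
  then show ?thesis using assms unfolding is_chart_def by (meson openin_open_eq)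
qed

text \<open>The map is the derivative of a transition map. The reverse transition map composes with
  it to the identity near \<open>p\<close>, so by the chain rule the derivative has a left
  inverse.\<close>

lemma to_chart_at_linear_inj:
  assumes M: "smooth_manifold M" and c: "c \<in> atlas M" and p: "p \<in> cimg c"
  shows "linear (to_chart_at M c p)" and "inj (to_chart_at M c p)"
proof -
  define d where "d = chart_at M (cinv c p)"
  have d: "d \<in> atlas M" "cinv c p \<in> cdom d"
    using M unfolding smooth_manifold_def d_def by blast+
  have ch: "is_chart c" "is_chart d" using M c d unfolding smooth_manifold_def by blast+
  note x = cinv_in_cdom[OF ch(1) p] cmap_cinv[OF ch(1) p]
  let ?\<phi> = "cmap d \<circ> cinv c" and ?\<psi> = "cmap c \<circ> cinv d"
  let ?V = "cmap c ` (cdom c \<inter> cdom d)"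
  have V: "open ?V" "p \<in> ?V"
    using open_chart_image[OF ch(1)] ch(2) x d(2) unfolding is_chart_def
    by (blast, metis IntI imageI)
  have "smooth_on ?V ?\<phi>" "smooth_on (cmap d ` (cdom d \<inter> cdom c)) ?\<psi>"
    using M c d unfolding smooth_manifold_def by blast+
  moreover have "?\<phi> p \<in> cmap d ` (cdom d \<inter> cdom c)" using x d by auto
  ultimately have "?\<phi> differentiable at p" "?\<psi> differentiable at (?\<phi> p)"
    using V(2) smooth_on_differentiable by blast+
  then have \<phi>: "(?\<phi> has_derivative to_chart_at M c p) (at p)"
    and \<psi>: "(?\<psi> has_derivative frechet_derivative ?\<psi> (at (?\<phi> p))) (at (?\<phi> p))"
    unfolding to_chart_at_def d_def by (simp_all add: frechet_derivative_works eta_contract_eq)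
  then show "linear (to_chart_at M c p)" by (blast intro: has_derivative_linear)
  have "(?\<psi> \<circ> ?\<phi> has_derivative frechet_derivative ?\<psi> (at (?\<phi> p)) \<circ> to_chart_at M c p) (at p)"
    using \<phi> \<psi> by (rule diff_chain_at)
  moreover have "(?\<psi> \<circ> ?\<phi> has_derivative id) (at p)"
    by (rule has_derivative_transform_within_open[OF has_derivative_id V])
       (auto simp: cinv_cmap[OF ch(1)] cinv_cmap[OF ch(2)])
  ultimately have "frechet_derivative ?\<psi> (at (?\<phi> p)) \<circ> to_chart_at M c p = id"
    by (rule has_derivative_unique)
  then show "inj (to_chart_at M c p)" by (metis inj_on_id inj_on_imageI2)
qed

text \<open>The coordinate metric is the pullback of an inner product along an injective linear
  map.\<close>

lemma
  assumes M: "riemannian_manifold M" and c: "c \<in> atlas M" and p: "p \<in> cimg c"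
  shows bilinear_local_metric: "bilinear (local_metric M c p)"
    and local_metric_nondegenerate: "v \<noteq> 0 \<Longrightarrow> local_metric M c p v v \<noteq> 0"
proof -
  have sm: "smooth_manifold M" and g: "bilinear (metric M (cinv c p))"
    using M unfolding riemannian_manifold_def by blast+
  note L = to_chart_at_linear_inj[OF sm c p]
  show "bilinear (local_metric M c p)"
    unfolding bilinear_def local_metric_def
    using g L(1) unfolding bilinear_def
    by (auto intro: linear_compose[OF L(1), unfolded o_def])
  show "local_metric M c p v v \<noteq> 0" if "v \<noteq> 0"
  proof -
    have "to_chart_at M c p v \<noteq> 0" using L that linear_injective_0 by blast
    then show ?thesis
      using M unfolding riemannian_manifold_def local_metric_def by (metis less_irrefl)
  qed
qed

text \<open>A name for the local function \<open>dg\<close> in \<open>christoffel\<close>, so that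
  its linearity in each argument can be stated separately.\<close>

definition metric_deriv ::
  "('m, 'e::euclidean_space) riemannian_structure \<Rightarrow> ('m, 'e) chart \<Rightarrow> 'e \<Rightarrow> 'e \<Rightarrow> 'e \<Rightarrow> 'e \<Rightarrow> real"
where
  "metric_deriv M c p d a b = frechet_derivative (\<lambda>q. local_metric M c q a b) (at p) d"

lemma linear_metric_deriv:
  assumes "riemannian_manifold M" "c \<in> atlas M" "p \<in> cimg c"
  shows "linear (\<lambda>d. metric_deriv M c p d a b)"
proof -
  have "(\<lambda>q. local_metric M c q a b) differentiable at p"
    using assms unfolding riemannian_manifold_def by (blast intro: smooth_on_differentiable)
  then show ?thesis unfolding metric_deriv_def by (rule linear_frechet_derivative)
qed

text \<open>The bilinearity identities of \<open>local_metric M c q\<close> hold for all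
  \<open>q\<close> in an open set around \<open>p\<close>, so they may be differentiated at
  \<open>p\<close>; uniqueness of derivatives transfers them.\<close>

lemma bilinear_metric_deriv:
  assumes M: "riemannian_manifold M" and c: "c \<in> atlas M" and p: "p \<in> cimg c"
  shows "bilinear (metric_deriv M c p d)"
proof -
  have op: "open (cimg c)"
    using M c unfolding riemannian_manifold_def smooth_manifold_def is_chart_def by blast
  have D: "((\<lambda>q. local_metric M c q a b) has_derivative (\<lambda>d. metric_deriv M c p d a b)) (at p)" for a b
  proof -
    have "(\<lambda>q. local_metric M c q a b) differentiable at p"
      using assms unfolding riemannian_manifold_def by (blast intro: smooth_on_differentiable)
    then show ?thesis by (simp add: metric_deriv_def frechet_derivative_works)
  qed
  have lin: "linear (\<lambda>u. local_metric M c q u w)" "linear (local_metric M c q w)" if "q \<in> cimg c" for q w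
    using bilinear_local_metric[OF M c that] unfolding bilinear_def by auto
  have eqD: "metric_deriv M c p d a b = F d"
    if "(f has_derivative F) (at p)" "\<And>q. q \<in> cimg c \<Longrightarrow> f q = local_metric M c q a b" for f F a b
    using has_derivative_unique[OF has_derivative_transform_within_open[OF that(1) op p that(2)] D]
    by metis
  show ?thesis
    unfolding bilinear_def
  proof (intro allI conjI linearI)
    fix x y z r
    show "metric_deriv M c p d x (y + z) = metric_deriv M c p d x y + metric_deriv M c p d x z"
      by (rule eqD[OF has_derivative_add[OF D D]]) (simp add: linear_add[OF lin(2)])
    show "metric_deriv M c p d x (r *\<^sub>R y) = r *\<^sub>R metric_deriv M c p d x y"
      by (rule eqD[OF has_derivative_scaleR_right[OF D]]) (simp add: linear_scale[OF lin(2)])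
    show "metric_deriv M c p d (y + z) x = metric_deriv M c p d y x + metric_deriv M c p d z x"
      by (rule eqD[OF has_derivative_add[OF D D]]) (simp add: linear_add[OF lin(1)])
    show "metric_deriv M c p d (r *\<^sub>R y) x = r *\<^sub>R metric_deriv M c p d y x"
      by (rule eqD[OF has_derivative_scaleR_right[OF D]]) (simp add: linear_scale[OF lin(1)])
  qed
qed

text \<open>Separates the coordinates of the vectors from finitely many coefficients that depend on
  the position alone, as the Lipschitz estimate in position and velocity requires.\<close>

lemma metric_deriv_Basis_expansion:
  assumes "riemannian_manifold M" "c \<in> atlas M" "p \<in> cimg c"
  shows "metric_deriv M c p d a b = (\<Sum>k\<in>Basis. (d \<bullet> k) *
    (\<Sum>i\<in>Basis. \<Sum>j\<in>Basis. ((a \<bullet> i) * (b \<bullet> j)) * metric_deriv M c p k i j))"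
  using linear_Basis_expansion[OF linear_metric_deriv[OF assms], of d a b]
    bilinear_Basis_expansion[OF bilinear_metric_deriv[OF assms], of _ a b]
  by simp

section \<open>Well-definedness, homogeneity and Lipschitz dependence of the Christoffel
  symbols\<close>

lemma linear_christoffel_rhs:
  assumes M: "riemannian_manifold M" and c: "c \<in> atlas M" and p: "p \<in> cimg c"
  shows "linear (\<lambda>y. (metric_deriv M c p u w y + metric_deriv M c p w u y - metric_deriv M c p y u w) / 2)"
proof -
  note bi = bilinear_metric_deriv[OF M c p] and lin = linear_metric_deriv[OF M c p]
  show ?thesis
    by (rule linearI)
       (simp_all add: bilinear_radd[OF bi] bilinear_rmul[OF bi] linear_add[OF lin] linear_scale[OF lin]
         field_simps)
qed

text \<open>The Koszul formula has exactly one solution because the metric is nondegenerate, so the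
  description in \<open>christoffel\<close> denotes it. The equivalence serves both to use the
  formula and to recognise its solution.\<close>

lemma christoffel_eq_metric_deriv:
  assumes M: "riemannian_manifold M" and c: "c \<in> atlas M" and p: "p \<in> cimg c"
  shows "(\<forall>y. local_metric M c p z y =
      (metric_deriv M c p u w y + metric_deriv M c p w u y - metric_deriv M c p y u w) / 2)
    \<longleftrightarrow> z = christoffel M c p u w"
proof -
  note ex1 = nondegenerate_bilinear_ex1[OF bilinear_local_metric[OF M c p] local_metric_nondegenerate[OF M c p]
      linear_christoffel_rhs[OF M c p, of u w]]
  show ?thesis
    unfolding christoffel_def Let_def metric_deriv_def[symmetric]
    using theI'[OF ex1] ex1 by blast
qed

text \<open>Every term on the right of the Koszul formula contains \<open>u\<close> twice, so the
  rescaled vector solves the rescaled formula. This makes linear reparametrizations of geodesics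
  geodesics.\<close>

lemma christoffel_scaleR:
  assumes M: "riemannian_manifold M" and c: "c \<in> atlas M" and p: "p \<in> cimg c"
  shows "christoffel M c p (s *\<^sub>R u) (s *\<^sub>R u) = s\<^sup>2 *\<^sub>R christoffel M c p u u"
proof -
  note eq = christoffel_eq_metric_deriv[OF M c p]
  note bi = bilinear_metric_deriv[OF M c p] and bg = bilinear_local_metric[OF M c p]
  have "local_metric M c p (christoffel M c p u u) y =
      (metric_deriv M c p u u y + metric_deriv M c p u u y - metric_deriv M c p y u u) / 2" for y
    using eq by blast
  note simps = this bilinear_lmul[OF bi] bilinear_rmul[OF bi] bilinear_lmul[OF bg]
    linear_scale[OF linear_metric_deriv[OF M c p]]
  have "s\<^sup>2 *\<^sub>R christoffel M c p u u = christoffel M c p (s *\<^sub>R u) (s *\<^sub>R u)"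
    by (subst eq[symmetric]) (simp only: simps, simp add: power2_eq_square field_simps)
  then show ?thesis ..
qed

text \<open>Each slot may hold the velocity or a fixed vector, which covers all three terms of the
  Koszul formula at once.\<close>

lemma loclip_at_metric_deriv:
  assumes M: "riemannian_manifold M" and c: "c \<in> atlas M" and p: "p \<in> cimg c"
    and d: "\<And>i. i \<in> Basis \<Longrightarrow> loclip_at (\<lambda>(p, u). d u \<bullet> i) (p, u)"
    and a: "\<And>i. i \<in> Basis \<Longrightarrow> loclip_at (\<lambda>(p, u). a u \<bullet> i) (p, u)"
    and b: "\<And>i. i \<in> Basis \<Longrightarrow> loclip_at (\<lambda>(p, u). b u \<bullet> i) (p, u)"
  shows "loclip_at (\<lambda>(p, u). metric_deriv M c p (d u) (a u) (b u)) (p, u)"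
proof -
  have op: "open (cimg c)"
    using M c unfolding riemannian_manifold_def smooth_manifold_def is_chart_def by blast
  \<comment> \<open>One order of smoothness is spent on the derivative of the metric, the other on
    its Lipschitz continuity.\<close>
  have Ck: "Ck_on (Suc (Suc 0)) (cimg c) (\<lambda>q. local_metric M c q i j)" for i j
    using M c unfolding riemannian_manifold_def smooth_on_def by blast
  then have "Ck_on (Suc 0) (cimg c) (\<lambda>q. metric_deriv M c q k i j)" for k i j
    unfolding metric_deriv_def by (subst (asm) Ck_on.simps(2)) blast
  then have "loclip_at (\<lambda>q. metric_deriv M c q k i j) p" for k i j
    using Ck_on_loclip_at op p by blast
  then have g: "loclip_at (\<lambda>(q, _). metric_deriv M c q k i j) (p, u)" for k i j
    by (rule loclip_at_compose_fst)
  have "loclip_at (\<lambda>x. \<Sum>k\<in>Basis. (d (snd x) \<bullet> k) *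
    (\<Sum>i\<in>Basis. \<Sum>j\<in>Basis. ((a (snd x) \<bullet> i) * (b (snd x) \<bullet> j)) * metric_deriv M c (fst x) k i j)) (p, u)"
    by (intro loclip_at_sum loclip_at_mult) (use d a b g in \<open>auto simp: case_prod_unfold\<close>)
  \<comment> \<open>The expansion is valid only over the chart image, which is open and therefore
    enough near \<open>(p, u)\<close>.\<close>
  moreover have "eventually (\<lambda>x. x \<in> cimg c \<times> UNIV) (nhds (p, u))"
    using op p by (intro eventually_nhds_in_open open_Times) auto
  then have "eventually (\<lambda>x. (case x of (p, u) \<Rightarrow> metric_deriv M c p (d u) (a u) (b u)) =
    (\<Sum>k\<in>Basis. (d (snd x) \<bullet> k) *
    (\<Sum>i\<in>Basis. \<Sum>j\<in>Basis. ((a (snd x) \<bullet> i) * (b (snd x) \<bullet> j)) * metric_deriv M c (fst x) k i j)))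
    (nhds (p, u))"
    by (rule eventually_mono) (clarsimp simp del: image_iff simp: metric_deriv_Basis_expansion[OF M c])
  ultimately show ?thesis by (rule loclip_at_cong[rotated])
qed

text \<open>The Koszul formula is a bilinear system whose form depends on the position only and
  whose right hand side depends on position and velocity; both are locally Lipschitz.\<close>

lemma loclip_at_christoffel:
  assumes M: "riemannian_manifold M" and c: "c \<in> atlas M" and p: "p \<in> cimg c"
  shows "loclip_at (\<lambda>(p, u). christoffel M c p u u) (p, u)"
proof (rule loclip_at_bilinear_solution[where U = "cimg c \<times> UNIV"
      and A = "\<lambda>(p, u). local_metric M c p"
      and \<beta> = "\<lambda>(p, u) y. (metric_deriv M c p u u y + metric_deriv M c p u u y - metric_deriv M c p y u u) / 2"])
  have op: "open (cimg c)"
    using M c unfolding riemannian_manifold_def smooth_manifold_def is_chart_def by blast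
  then show "open (cimg c \<times> (UNIV :: 'b set))" by (intro open_Times) auto
  show "(p, u) \<in> cimg c \<times> UNIV" using p by simp
  fix x :: "'b \<times> 'b" assume x: "x \<in> cimg c \<times> UNIV"
  then have x: "fst x \<in> cimg c" by auto
  show "bilinear (case x of (p, u) \<Rightarrow> local_metric M c p)"
    using bilinear_local_metric[OF M c x] by (simp add: case_prod_unfold)
  show "linear (case x of (p, u) \<Rightarrow> \<lambda>y.
      (metric_deriv M c p u u y + metric_deriv M c p u u y - metric_deriv M c p y u u) / 2)"
    using linear_christoffel_rhs[OF M c x, of "snd x" "snd x"] by (simp add: case_prod_unfold)
  show "(case x of (p, u) \<Rightarrow> local_metric M c p) (case x of (p, u) \<Rightarrow> christoffel M c p u u) y =
     (case x of (p, u) \<Rightarrow> \<lambda>y.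
      (metric_deriv M c p u u y + metric_deriv M c p u u y - metric_deriv M c p y u u) / 2) y" for y
    using christoffel_eq_metric_deriv[OF M c x, of "christoffel M c (fst x) (snd x) (snd x)" "snd x" "snd x"]
    by (simp add: case_prod_unfold)
next
  show "(case (p, u) of (p, u) \<Rightarrow> local_metric M c p) v v \<noteq> 0" if "v \<noteq> 0" for v
    using local_metric_nondegenerate[OF M c p that] by simp
next
  fix i j :: 'b
  have op: "open (cimg c)"
    using M c unfolding riemannian_manifold_def smooth_manifold_def is_chart_def by blast
  have "Ck_on (Suc 0) (cimg c) (\<lambda>q. local_metric M c q i j)"
    using M c unfolding riemannian_manifold_def smooth_on_def by blast
  then have "loclip_at (\<lambda>q. local_metric M c q i j) p"
    using Ck_on_loclip_at op p by blast
  then have "loclip_at (\<lambda>(q, _). local_metric M c q i j) (p, u)"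
    by (rule loclip_at_compose_fst)
  then show "loclip_at (\<lambda>x. (case x of (p, u) \<Rightarrow> local_metric M c p) i j) (p, u)"
    by (simp add: case_prod_unfold)
next
  fix j :: 'b
  have l: "loclip_at (\<lambda>(p, u). u \<bullet> i) (p, u)" for i :: 'b
    by (rule loclip_at_bounded_linear)
       (auto simp: case_prod_unfold intro!: bounded_linear_intros)
  have k: "loclip_at (\<lambda>(p, u). j \<bullet> i) (p, u)" for i :: 'b
    using loclip_at_const by (simp add: case_prod_unfold)
  have "loclip_at (\<lambda>x. (1/2) * ((\<lambda>(p, u). metric_deriv M c p u u j) x + (\<lambda>(p, u). metric_deriv M c p u u j) x
      + - (\<lambda>(p, u). metric_deriv M c p j u u) x)) (p, u)"
    by (intro loclip_at_mult loclip_at_const loclip_at_add loclip_at_minus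
        loclip_at_metric_deriv[OF M c p] l k)
  then show "loclip_at (\<lambda>x. (case x of (p, u) \<Rightarrow> \<lambda>y.
      (metric_deriv M c p u u y + metric_deriv M c p u u y - metric_deriv M c p y u u) / 2) j) (p, u)"
    by (simp add: case_prod_unfold)
qed

section \<open>Geodesics\<close>

text \<open>In a chart, position and velocity together solve a first-order system with locally
  Lipschitz right hand side, and both curves start from the same data.\<close>

lemma geodesics_locally_agree:
  assumes M: "riemannian_manifold M" and c: "c \<in> atlas M"
    and geo: "geodesic M \<gamma>" "geodesic M \<delta>"
    and t: "\<gamma> t = \<delta> t" "\<gamma> t \<in> cdom c"
    and v: "((cmap c \<circ> \<gamma>) has_vector_derivative v) (at t)"
      "((cmap c \<circ> \<delta>) has_vector_derivative v) (at t)"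
  shows "eventually (\<lambda>s. \<gamma> s = \<delta> s) (nhds t)"
proof -
  have ch: "is_chart c" using M c unfolding riemannian_manifold_def smooth_manifold_def by blast
  define F where "F = (\<lambda>(p, u). (u, - christoffel M c p u u))"
  have lift: "\<exists>X. (\<forall>s. fst (X s) = cmap c (\<eta> s)) \<and> X t = (cmap c (\<gamma> t), v) \<and>
      eventually (\<lambda>s. \<eta> s \<in> cdom c) (nhds t) \<and>
      eventually (\<lambda>s. (X has_vector_derivative F (X s)) (at s)) (nhds t)"
    if \<eta>: "geodesic M \<eta>" "\<eta> t = \<gamma> t" "((cmap c \<circ> \<eta>) has_vector_derivative v) (at t)" for \<eta>
  proof -
    obtain \<sigma> where \<sigma>: "\<And>s. \<eta> s \<in> cdom c \<Longrightarrow> ((cmap c \<circ> \<eta>) has_vector_derivative \<sigma> s) (at s) \<and>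
        (\<sigma> has_vector_derivative - christoffel M c (cmap c (\<eta> s)) (\<sigma> s) (\<sigma> s)) (at s)"
      using \<eta>(1) c unfolding geodesic_def by blast
    define X where "X s = ((cmap c \<circ> \<eta>) s, \<sigma> s)" for s
    \<comment> \<open>The velocity \<open>\<sigma>\<close> is only known to exist; uniqueness of
      derivatives fixes its value at \<open>t\<close>.\<close>
    have "\<sigma> t = v" using \<sigma> \<eta>(2,3) t(2) vector_derivative_unique_at by metis
    moreover have ev: "eventually (\<lambda>s. \<eta> s \<in> cdom c) (nhds t)"
    proof -
      have "open (\<eta> -` cdom c)"
        using \<eta>(1) ch unfolding geodesic_def is_chart_def by (intro open_vimage) auto
      from eventually_nhds_in_open[OF this] show ?thesis using \<eta>(2) t(2) by simp
    qed
    moreover have "(X has_vector_derivative F (X s)) (at s)" if "\<eta> s \<in> cdom c" for s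
      using \<sigma>[OF that] unfolding X_def F_def by (auto intro!: has_vector_derivative_Pair simp: o_def)
    ultimately show ?thesis
      using \<eta>(2) by (intro exI[of _ X]) (auto simp: X_def elim: eventually_mono)
  qed
  obtain X where X: "\<And>s. fst (X s) = cmap c (\<gamma> s)" "X t = (cmap c (\<gamma> t), v)"
      "eventually (\<lambda>s. \<gamma> s \<in> cdom c) (nhds t)"
      "eventually (\<lambda>s. (X has_vector_derivative F (X s)) (at s)) (nhds t)"
    using lift[OF geo(1) refl v(1)] by blast
  obtain Y where Y: "\<And>s. fst (Y s) = cmap c (\<delta> s)" "Y t = (cmap c (\<gamma> t), v)"
      "eventually (\<lambda>s. \<delta> s \<in> cdom c) (nhds t)"
      "eventually (\<lambda>s. (Y has_vector_derivative F (Y s)) (at s)) (nhds t)"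
    using lift[OF geo(2) t(1)[symmetric] v(2)] by blast
  have "loclip_at (\<lambda>x. (snd x, - (case x of (p, u) \<Rightarrow> christoffel M c p u u))) (cmap c (\<gamma> t), v)"
    using t(2) by (intro loclip_at_Pair loclip_at_minus loclip_at_christoffel[OF M c]
        loclip_at_bounded_linear bounded_linear_snd) auto
  then have "loclip_at F (X t)" by (simp add: F_def X(2) case_prod_unfold)
  then have "eventually (\<lambda>s. X s = Y s) (nhds t)"
    using X Y by (intro ode_locally_unique[of F X t Y]) auto
  \<comment> \<open>Near \<open>t\<close> both curves lie in the chart domain, where equal
    coordinates mean equal points.\<close>
  with X(3) Y(3) show ?thesis
  proof eventually_elim
    case (elim s)
    then have "cmap c (\<gamma> s) = cmap c (\<delta> s)" using X(1) Y(1) by metis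
    then show ?case using elim cinv_cmap[OF ch] by metis
  qed
qed

lemma geodesic_from_unique:
  assumes M: "riemannian_manifold M"
    and g: "geodesic_from M x v \<gamma>" "geodesic_from M x v \<delta>"
  shows "\<gamma> = \<delta>"
proof -
  have geo: "geodesic M \<gamma>" "geodesic M \<delta>" using g unfolding geodesic_from_def by auto
  have cont: "continuous_on UNIV \<gamma>" "continuous_on UNIV \<delta>"
    using geo unfolding geodesic_def by auto
  have chart_at: "chart_at M y \<in> atlas M" "y \<in> cdom (chart_at M y)" for y
    using M unfolding riemannian_manifold_def smooth_manifold_def by blast+
  \<comment> \<open>Agreement around a time, and not merely at it, makes the set open and carries
    equality of velocities along.\<close>
  define E where "E = {t. eventually (\<lambda>s. \<gamma> s = \<delta> s) (nhds t)}"
  have eqE: "\<gamma> t = \<delta> t" if "t \<in> E" for t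
    using that eventually_nhds_x_imp_x[of "\<lambda>s. \<gamma> s = \<delta> s"] unfolding E_def by blast
  have "0 \<in> E"
    unfolding E_def mem_Collect_eq
    by (rule geodesics_locally_agree[OF M chart_at(1)[of x] geo, where v = v])
       (use g chart_at(2) in \<open>auto simp: geodesic_from_def\<close>)
  moreover have "open E"
    unfolding E_def by (subst open_subopen) (auto simp: eventually_nhds)
  moreover have "closed E"
    unfolding closed_sequential_limits
  proof (intro allI impI, elim conjE)
    fix X t assume "\<forall>n. X n \<in> E" and Xt: "X \<longlonglongrightarrow> t"
    then have X: "\<And>n. X n \<in> E" by blast
    have lim: "(\<lambda>n. \<eta> (X n)) \<longlonglongrightarrow> \<eta> t" if "continuous_on UNIV \<eta>" for \<eta> :: "real \<Rightarrow> 'a"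
      using that isCont_tendsto_compose[OF _ Xt, of \<eta>] by (simp add: continuous_on_eq_continuous_at)
    have eq: "\<gamma> t = \<delta> t"
      using LIMSEQ_unique[OF lim[OF cont(1)], of "\<delta> t"] lim[OF cont(2)] eqE[OF X] by simp
    define c where "c = chart_at M (\<gamma> t)"
    have c: "c \<in> atlas M" "\<gamma> t \<in> cdom c" "\<delta> t \<in> cdom c" using chart_at eq by (auto simp: c_def)
    have ch: "open (cdom c)"
      using M c unfolding riemannian_manifold_def smooth_manifold_def is_chart_def by blast
    obtain \<sigma> where \<sigma>: "\<And>s. \<gamma> s \<in> cdom c \<Longrightarrow> ((cmap c \<circ> \<gamma>) has_vector_derivative \<sigma> s) (at s) \<and>
        (\<sigma> has_vector_derivative - christoffel M c (cmap c (\<gamma> s)) (\<sigma> s) (\<sigma> s)) (at s)"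
      using geo(1) c(1) unfolding geodesic_def by blast
    obtain \<tau> where \<tau>: "\<And>s. \<delta> s \<in> cdom c \<Longrightarrow> ((cmap c \<circ> \<delta>) has_vector_derivative \<tau> s) (at s) \<and>
        (\<tau> has_vector_derivative - christoffel M c (cmap c (\<delta> s)) (\<tau> s) (\<tau> s)) (at s)"
      using geo(2) c(1) unfolding geodesic_def by blast
    \<comment> \<open>For closedness the velocities must agree in the limit too. They are
      differentiable by the geodesic equation, hence continuous at \<open>t\<close>.\<close>
    have lim\<sigma>: "(\<lambda>n. \<sigma> (X n)) \<longlonglongrightarrow> \<sigma> t"
      by (rule isCont_tendsto_compose[OF has_vector_derivative_continuous[OF conjunct2[OF \<sigma>[OF c(2)]]] Xt])
    have lim\<tau>: "(\<lambda>n. \<tau> (X n)) \<longlonglongrightarrow> \<tau> t"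
      by (rule isCont_tendsto_compose[OF has_vector_derivative_continuous[OF conjunct2[OF \<tau>[OF c(3)]]] Xt])
    \<comment> \<open>Only eventually, since the chart is chosen around the limit point. Once
      inside, the curves coincide near \<open>X n\<close> and so have the same derivative
      there.\<close>
    have "eventually (\<lambda>n. \<sigma> (X n) = \<tau> (X n)) sequentially"
    proof -
      have "eventually (\<lambda>n. \<gamma> (X n) \<in> cdom c) sequentially"
        using lim[OF cont(1)] ch c(2) by (rule topological_tendstoD)
      then show ?thesis
      proof eventually_elim
        case (elim n)
        then have "\<gamma> (X n) \<in> cdom c" "\<delta> (X n) \<in> cdom c" using eqE[OF X, of n] by simp_all
        then have "((cmap c \<circ> \<gamma>) has_vector_derivative \<sigma> (X n)) (at (X n))"
          "((cmap c \<circ> \<delta>) has_vector_derivative \<tau> (X n)) (at (X n))"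
          using \<sigma> \<tau> by blast+
        moreover obtain S where S: "open S" "X n \<in> S" "\<And>s. s \<in> S \<Longrightarrow> \<gamma> s = \<delta> s"
          using X[of n] unfolding E_def eventually_nhds by auto
        ultimately show ?case
          by - (rule vector_derivative_unique_at[OF has_vector_derivative_transform_within_open[
                of "cmap c \<circ> \<gamma>" _ "X n" S "cmap c \<circ> \<delta>"]], simp_all)
      qed
    qed
    from tendsto_cong[OF this] lim\<sigma> have "(\<lambda>n. \<tau> (X n)) \<longlonglongrightarrow> \<sigma> t" by blast
    then have "\<sigma> t = \<tau> t" using lim\<tau> by (rule LIMSEQ_unique)
    then show "t \<in> E"
      unfolding E_def mem_Collect_eq
      using \<sigma>[OF c(2)] \<tau>[OF c(3)]
      by (intro geodesics_locally_agree[OF M c(1) geo eq c(2)]) auto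
  qed
  ultimately have "E = UNIV" using clopen[of E] by auto
  then show ?thesis using eqE by blast
qed

section \<open>Rescaled geodesics and the exponential map along a ray\<close>

lemma geodesic_reparametrize:
  assumes M: "riemannian_manifold M" and g: "geodesic_from M x v \<gamma>"
  shows "geodesic_from M x (r *\<^sub>R v) (\<lambda>t. \<gamma> (r * t))"
proof -
  have scale: "((\<lambda>t. f (r * t)) has_vector_derivative r *\<^sub>R d) (at t)"
    if "(f has_vector_derivative d) (at (r * t))" for f :: "real \<Rightarrow> 'b" and d t
  proof -
    have "((*) r has_vector_derivative r) (at t)"
      by (auto intro!: derivative_eq_intros)
    from vector_diff_chain_at[OF this that] show ?thesis by (simp add: o_def)
  qed
  have "geodesic M (\<lambda>t. \<gamma> (r * t))"
    unfolding geodesic_def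
  proof (intro conjI ballI)
    have "continuous_on UNIV \<gamma>" using g unfolding geodesic_from_def geodesic_def by blast
    then show "continuous_on UNIV (\<lambda>t. \<gamma> (r * t))"
      by (rule continuous_on_compose2) (auto intro: continuous_intros)
    fix c assume c: "c \<in> atlas M"
    obtain \<sigma> where \<sigma>: "\<And>s. \<gamma> s \<in> cdom c \<Longrightarrow> ((cmap c \<circ> \<gamma>) has_vector_derivative \<sigma> s) (at s) \<and>
        (\<sigma> has_vector_derivative - christoffel M c (cmap c (\<gamma> s)) (\<sigma> s) (\<sigma> s)) (at s)"
      using g c unfolding geodesic_from_def geodesic_def by blast
    show "\<exists>\<sigma>'. \<forall>t. \<gamma> (r * t) \<in> cdom c \<longrightarrow>
        ((cmap c \<circ> (\<lambda>t. \<gamma> (r * t))) has_vector_derivative \<sigma>' t) (at t) \<and>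
        (\<sigma>' has_vector_derivative
          - christoffel M c (cmap c (\<gamma> (r * t))) (\<sigma>' t) (\<sigma>' t)) (at t)"
    proof (intro exI allI impI conjI)
      fix t assume t: "\<gamma> (r * t) \<in> cdom c"
      show "((cmap c \<circ> (\<lambda>t. \<gamma> (r * t))) has_vector_derivative r *\<^sub>R \<sigma> (r * t)) (at t)"
        using scale[of "cmap c \<circ> \<gamma>"] \<sigma>[OF t] by (simp add: o_def)
      \<comment> \<open>The acceleration picks up the factor \<open>r\<close> twice, matching the
        quadratic homogeneity of the Christoffel term for every real \<open>r\<close>.\<close>
      have "((\<lambda>t. r *\<^sub>R \<sigma> (r * t)) has_vector_derivative
          r *\<^sub>R (r *\<^sub>R (- christoffel M c (cmap c (\<gamma> (r * t))) (\<sigma> (r * t)) (\<sigma> (r * t))))) (at t)"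
        using \<sigma>[OF t]
        by (intro bounded_linear.has_vector_derivative[OF bounded_linear_scaleR_right] scale) auto
      then show "((\<lambda>t. r *\<^sub>R \<sigma> (r * t)) has_vector_derivative
          - christoffel M c (cmap c (\<gamma> (r * t))) (r *\<^sub>R \<sigma> (r * t)) (r *\<^sub>R \<sigma> (r * t))) (at t)"
        using t by (simp add: christoffel_scaleR[OF M c] power2_eq_square)
    qed
  qed
  then show ?thesis
    using g scale[of "cmap (chart_at M x) \<circ> \<gamma>" v 0] unfolding geodesic_from_def by (simp add: o_def)
qed

text \<open>The geodesic with velocity \<open>t *\<^sub>R v\<close> is the one with velocity
  \<open>v\<close> run at speed \<open>t\<close>, so its value at time 1 is
  \<open>\<gamma> t\<close>; uniqueness lets the description in \<open>exp_map\<close> pick this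
  value.\<close>

lemma exp_map_eq:
  assumes M: "riemannian_manifold M" and g: "geodesic_from M x v \<gamma>"
  shows "exp_map M x (t *\<^sub>R v) = \<gamma> t"
  unfolding exp_map_def
  using geodesic_reparametrize[OF M g, of t] geodesic_from_unique[OF M]
  by (intro the_equality) (auto intro!: exI[of _ "\<lambda>s. \<gamma> (t * s)"], metis mult.right_neutral)

lemma tendsto_exp_map_ray:
  assumes M: "riemannian_manifold M" and "geodesically_complete M"
  shows "((\<lambda>t. exp_map M x (t *\<^sub>R v)) \<longlongrightarrow> x) (at_right 0)"
proof -
  obtain \<gamma> where g: "geodesic_from M x v \<gamma>" using assms(2) unfolding geodesically_complete_def by blast
  then have "isCont \<gamma> 0" "\<gamma> 0 = x"
    unfolding geodesic_from_def geodesic_def by (auto simp: continuous_on_eq_continuous_at)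
  then have "(\<gamma> \<longlongrightarrow> x) (at_right 0)"
    by (metis continuous_within_subset continuous_within subset_UNIV)
  then show ?thesis by (simp add: exp_map_eq[OF M g])
qed

section \<open>Interval valued functions\<close>

lemma
  fixes a b :: real
  assumes "a \<le> b"
  shows lower_Interval: "lower (Interval (a, b)) = a"
    and upper_Interval: "upper (Interval (a, b)) = b"
  using assms by (auto simp: lower_def upper_def Interval_inverse)

text \<open>The upper end of a gH-difference is the larger of the two endpoint differences, so if it
  is negative, both endpoints have strictly decreased.\<close>

lemma has_gH_dir_deriv_eventually_iprec:
  assumes "has_gH_dir_deriv M f x v L" "upper L < 0"
  shows "eventually (\<lambda>t. f (exp_map M x (t *\<^sub>R v)) \<prec>\<^sub>I f x) (at_right 0)"
proof -
  let ?q = "\<lambda>t. (1 / t) *\<^sub>I (f (exp_map M x (t *\<^sub>R v)) -\<^sub>g\<^sub>H f x)"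
  \<comment> \<open>A distance below \<open>- upper L\<close> keeps the upper end of the quotient
    negative.\<close>
  have "eventually (\<lambda>t. hausdorff_dist (?q t) L < - upper L) (at_right 0)"
    using assms unfolding has_gH_dir_deriv_def itendsto_def by (intro order_tendstoD(2)) auto
  moreover have "eventually (\<lambda>t::real. t > 0) (at_right 0)" by (rule eventually_at_right_less)
  ultimately show ?thesis
  proof eventually_elim
    case (elim t)
    let ?A = "f (exp_map M x (t *\<^sub>R v))"
    let ?m = "min (lower ?A - lower (f x)) (upper ?A - upper (f x))"
    let ?n = "max (lower ?A - lower (f x)) (upper ?A - upper (f x))"
    have d: "lower (?A -\<^sub>g\<^sub>H f x) = ?m" "upper (?A -\<^sub>g\<^sub>H f x) = ?n"
      unfolding gH_diff_def by (simp_all add: lower_Interval upper_Interval)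
    have "?m / t \<le> ?n / t" using elim by (intro divide_right_mono) auto
    then have "upper (?q t) = ?n / t"
      using elim unfolding iscale_def d by (simp add: upper_Interval)
    moreover have "upper (?q t) < 0" using elim unfolding hausdorff_dist_def by auto
    ultimately have "?n < 0" using elim by (simp add: divide_less_0_iff)
    then show ?case unfolding iprec_def ipreceq_def by auto
  qed
qed

text \<open>By the triangle inequality the distance of two limits is below a quantity tending to 0.
  Hence the description in \<open>gH_dir_deriv\<close> is meaningful.\<close>

lemma has_gH_dir_deriv_unique:
  assumes "has_gH_dir_deriv M f x v L" "has_gH_dir_deriv M f x v L'"
  shows "L = L'"
proof -
  let ?q = "\<lambda>t. (1 / t) *\<^sub>I (f (exp_map M x (t *\<^sub>R v)) -\<^sub>g\<^sub>H f x)"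
  have "((\<lambda>t. hausdorff_dist (?q t) L + hausdorff_dist (?q t) L') \<longlongrightarrow> 0 + 0) (at_right 0)"
    using assms unfolding has_gH_dir_deriv_def itendsto_def by (rule tendsto_add)
  moreover have "hausdorff_dist L L' \<le> hausdorff_dist A L + hausdorff_dist A L'" for A
    unfolding hausdorff_dist_def by linarith
  ultimately have "hausdorff_dist L L' \<le> 0"
    by (intro tendsto_lowerbound[of _ 0 "at_right (0::real)"]) (auto intro!: always_eventually)
  then show ?thesis unfolding hausdorff_dist_def by (auto simp: interval_eq_iff)
qed

section \<open>The variational inequality at an efficient point\<close>

theorem theorem4p3:
  fixes M :: "('m::{t2_space,second_countable_topology}, 'e::euclidean_space) riemannian_structure"
    and D :: "'m set" and x\<^sub>0 :: 'm and f :: "'m \<Rightarrow> real interval"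
    and T :: "'m \<Rightarrow> 'e \<Rightarrow> real interval"
  assumes "hadamard_manifold M"
    and "open D" and "x\<^sub>0 \<in> D"
    and "gH_gateaux_differentiable M f x\<^sub>0"
    and "efficient_point D f x\<^sub>0"
    and "\<forall>y\<in>D. \<forall>a<0. gateaux_deriv M f x\<^sub>0 (exp_map_inv M x\<^sub>0 y) \<noteq> Interval (a, 0)"
    and "T x\<^sub>0 = gateaux_deriv M f x\<^sub>0"
  shows "stampacchia_solution M D T x\<^sub>0"
proof -
  have M: "riemannian_manifold M" "geodesically_complete M"
    using assms(1) unfolding hadamard_manifold_def by auto
  have "\<not> gateaux_deriv M f x\<^sub>0 (exp_map_inv M x\<^sub>0 y) \<prec>\<^sub>I 0" if y: "y \<in> D" for y
  proof
    define v where "v = exp_map_inv M x\<^sub>0 y"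
    define L where "L = gateaux_deriv M f x\<^sub>0 v"
    assume "gateaux_deriv M f x\<^sub>0 (exp_map_inv M x\<^sub>0 y) \<prec>\<^sub>I 0"
    then have L: "lower L \<le> 0" "upper L \<le> 0" "L \<noteq> 0"
      by (auto simp: L_def v_def iprec_def ipreceq_def)
    obtain L' where L': "has_gH_dir_deriv M f x\<^sub>0 v L'"
      using assms(4) unfolding gH_gateaux_differentiable_def gH_dir_differentiable_def by blast
    then have der: "has_gH_dir_deriv M f x\<^sub>0 v L"
      unfolding L_def gateaux_deriv_def gH_dir_deriv_def
      by (rule theI2) (use L' has_gH_dir_deriv_unique in blast)+
    have "upper L \<noteq> 0"
    proof
      assume "upper L = 0"
      then have "lower L \<noteq> 0" using L(3) by (auto simp: interval_eq_iff)
      \<comment> \<open>Here \<open>lower L\<close> is nonpositive and nonzero, so this is precisely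
        a value that the hypothesis on the derivative excludes.\<close>
      moreover have "L = Interval (lower L, 0)"
        using L(1) \<open>upper L = 0\<close> by (auto simp: interval_eq_iff lower_Interval upper_Interval)
      ultimately show False using assms(6) y L(1) unfolding L_def v_def by force
    qed
    then have "eventually (\<lambda>t. f (exp_map M x\<^sub>0 (t *\<^sub>R v)) \<prec>\<^sub>I f x\<^sub>0) (at_right 0)"
      using L(2) by (intro has_gH_dir_deriv_eventually_iprec[OF der]) simp
    moreover have "eventually (\<lambda>t. exp_map M x\<^sub>0 (t *\<^sub>R v) \<in> D) (at_right 0)"
      using tendsto_exp_map_ray[OF M] assms(2,3) by (rule topological_tendstoD)
    \<comment> \<open>For small positive \<open>t\<close> a point of \<open>D\<close> would have a
      smaller value than \<open>x\<^sub>0\<close>. The filter \<open>at_right 0\<close> is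
      nontrivial, so this is absurd.\<close>
    ultimately have "eventually (\<lambda>t::real. False) (at_right 0)"
      by eventually_elim (use assms(5) in \<open>auto simp: efficient_point_def\<close>)
    then show False by simp
  qed
  then show ?thesis
    using assms(3,4,7) unfolding stampacchia_solution_def gH_gateaux_differentiable_def by simp
qed

end
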